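(* Let $d\ge 2$, let $(\mathbb{R}^d,\|\cdot\|)$ be an arbitrary $d$-dimensional Minkowski space, and let $P_0$ be a point on the Minkowskian $(d-1)$-sphere $S(o,1)=\{X\in\mathbb{R}^d:\|X\|=1\}$. Then there exists an $AG$-quasiregular $d$-simplex $T$ with $P_0$ as one of its vertices and $S(o,1)$ as circumsphere.
   Context: A Minkowski space is $\mathbb{R}^d$ equipped with an arbitrary norm $\|\cdot\|$; $o$ denotes the origin. A circumsphere of a $d$-simplex $T$ is a Minkowskian sphere $\{Y:\|Y-M\|=r\}$ ($r>0$) containing all vertices of $T$; its center $M$ is a circumcenter of $T$. Circumcenters need not exist and need not be unique. The centroid of a $d$-simplex with vertices $A_0,\dots,A_d$ is $G=\frac1{d+1}\sum_{i=0}^dA_i$. A $d$-simplex possessing a circumcenter is $AG$-quasiregular if its centroid is a circumcenter. *)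

theory Defs
  imports "HOL-Analysis.Analysis"
begin

text \<open>
  A Minkowski space is the vector space \<^typ>\<open>real ^ 'n\<close>, of dimension \<open>d = CARD('n)\<close>, together with
  an arbitrary norm \<open>N\<close>, unrelated to the Euclidean norm of the type class.
\<close>

definition is_norm :: "('a::real_vector \<Rightarrow> real) \<Rightarrow> bool" where
  "is_norm N \<longleftrightarrow>
     (\<forall>x. 0 \<le> N x) \<and>
     (\<forall>x. N x = 0 \<longleftrightarrow> x = 0) \<and>
     (\<forall>c x. N (c *\<^sub>R x) = \<bar>c\<bar> * N x) \<and>
     (\<forall>x y. N (x + y) \<le> N x + N y)"

definition mink_sphere :: "('a::real_vector \<Rightarrow> real) \<Rightarrow> 'a \<Rightarrow> real \<Rightarrow> 'a set" where
  "mink_sphere N M r = {Y. N (Y - M) = r}"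

text \<open>
  Simplices are solid, as in the library's \<open>k simplex T\<close>: the convex hull of \<open>k + 1\<close> affinely
  independent points, which are recovered from \<open>T\<close> as its extreme points.
\<close>

definition vertices :: "'a::real_vector set \<Rightarrow> 'a set" where
  "vertices T = {x. x extreme_point_of T}"

definition centroid :: "'a::real_vector set \<Rightarrow> 'a" where
  "centroid T = (1 / real (card (vertices T))) *\<^sub>R (\<Sum>A\<in>vertices T. A)"

definition is_circumsphere :: "('a::real_vector \<Rightarrow> real) \<Rightarrow> 'a set \<Rightarrow> 'a set \<Rightarrow> bool" where
  "is_circumsphere N S T \<longleftrightarrow> (\<exists>M r. r > 0 \<and> S = mink_sphere N M r \<and> vertices T \<subseteq> S)"

definition is_circumcenter :: "('a::real_vector \<Rightarrow> real) \<Rightarrow> 'a \<Rightarrow> 'a set \<Rightarrow> bool" where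
  "is_circumcenter N M T \<longleftrightarrow> (\<exists>r>0. is_circumsphere N (mink_sphere N M r) T)"

text \<open>
  Circumcenters need not be unique, so the centroid is only required to be one of them.
\<close>

definition AG_quasiregular :: "(real ^ 'n \<Rightarrow> real) \<Rightarrow> (real ^ 'n) set \<Rightarrow> bool" where
  "AG_quasiregular N T \<longleftrightarrow>
     int CARD('n) simplex T \<and> (\<exists>M. is_circumcenter N M T) \<and> is_circumcenter N (centroid T) T"

end

theory Submission
  imports Defs
begin

text \<open>
  Unit vectors with sum \<open>0\<close> that include \<open>P0\<close> are found by descending dimension. Let \<open>p\<close> be inside
  the unit sphere and let \<open>p \<plusminus> a\<close> be on it, with \<open>a\<close> in a \<open>k\<close>-dimensional subspace \<open>V\<close>. If
  \<open>p + a\<close> is one of \<open>k + 1\<close> vertices with centroid \<open>p\<close>, the others have centroid \<open>q = p - a / k\<close>,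
  which is again inside the sphere. For \<open>k \<ge> 2\<close> some chord \<open>q \<plusminus> b\<close> with \<open>b \<in> V\<close> is bisected by
  \<open>q\<close>, because \<open>V - {0}\<close> is connected and reversing \<open>b\<close> swaps the two halves of a chord. The vector
  \<open>b\<close> is not a multiple of \<open>a\<close>, since the chord of the line \<open>p + \<real>a\<close> has midpoint \<open>p \<noteq> q\<close>. So \<open>b\<close>
  lies in a hyperplane of \<open>V\<close> that misses \<open>a\<close>, and the construction continues there with \<open>q\<close> and
  \<open>b\<close>. For \<open>k = 1\<close> the two points \<open>p \<plusminus> a\<close> are the vertices.
\<close>

lemma
  assumes "is_norm N"
  shows is_norm_scaleR: "N (c *\<^sub>R x) = \<bar>c\<bar> * N x"
    and is_norm_triangle: "N (x + y) \<le> N x + N y"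
    and is_norm_minus: "N (- x) = N x"
    and is_norm_pos: "x \<noteq> 0 \<Longrightarrow> 0 < N x"
    and is_norm_zero: "N 0 = 0"
proof -
  show *: "N (c *\<^sub>R x) = \<bar>c\<bar> * N x" for c x
    using assms by (simp add: is_norm_def)
  show "N (x + y) \<le> N x + N y" "N 0 = 0"
    using assms by (auto simp: is_norm_def)
  show "N (- x) = N x"
    using *[of "-1" x] by simp
  show "x \<noteq> 0 \<Longrightarrow> 0 < N x"
    using assms unfolding is_norm_def by (metis less_eq_real_def)
qed

lemma is_norm_convex_on:
  assumes "is_norm N"
  shows "convex_on UNIV N"
proof (rule convex_onI)
  fix t :: real and x y
  assume "0 < t" "t < 1"
  then show "N ((1 - t) *\<^sub>R x + t *\<^sub>R y) \<le> (1 - t) * N x + t * N y"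
    using is_norm_triangle[OF assms, of "(1 - t) *\<^sub>R x" "t *\<^sub>R y"]
    by (simp add: is_norm_scaleR[OF assms])
qed simp

lemma is_norm_continuous_on:
  fixes N :: "'a::euclidean_space \<Rightarrow> real"
  assumes "is_norm N"
  shows "continuous_on S N"
  using convex_on_continuous[OF open_UNIV is_norm_convex_on[OF assms]] continuous_on_subset
  by blast

text \<open>The point is a convex combination of \<open>p\<close> and
  \<open>p + s *\<^sub>R x\<close> in which \<open>p\<close> has positive weight, so strictness
  comes from \<open>N p < 1\<close>. Hence a ray from an inner point meets the sphere at most once,
  although \<open>N\<close> need not be strictly convex.\<close>

lemma is_norm_radial_less_one:
  assumes N: "is_norm N" and p: "N p < 1" and s: "N (p + s *\<^sub>R x) \<le> 1" and "0 \<le> r" "r < s"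
  shows "N (p + r *\<^sub>R x) < 1"
proof -
  have s0: "0 < s" using assms by linarith
  define t where "t = r / s"
  have t: "0 \<le> t" "t < 1" and r: "r = t * s"
    using assms s0 by (auto simp: t_def)
  have "p + r *\<^sub>R x = (1 - t) *\<^sub>R p + t *\<^sub>R (p + s *\<^sub>R x)"
    by (simp add: r algebra_simps)
  then have "N (p + r *\<^sub>R x) \<le> (1 - t) * N p + t * N (p + s *\<^sub>R x)"
    using is_norm_triangle[OF N, of "(1 - t) *\<^sub>R p" "t *\<^sub>R (p + s *\<^sub>R x)"] t
    by (simp add: is_norm_scaleR[OF N])
  also have "\<dots> < (1 - t) * 1 + t * 1"
    using p s t by (intro add_less_le_mono mult_left_mono mult_strict_left_mono) auto
  finally show ?thesis by simp
qed

lemma is_norm_chord_parameter: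
  assumes N: "is_norm N" and p: "N p < 1" and a: "N (p + a) = 1" "N (p - a) = 1"
    and t: "N (p + t *\<^sub>R a) = 1"
  shows "\<bar>t\<bar> = 1"
proof -
  have *: "t = 1" if "0 \<le> t" "N (p + a) = 1" "N (p + t *\<^sub>R a) = 1" for t a
    using is_norm_radial_less_one[OF N p, of 1 a t] is_norm_radial_less_one[OF N p, of t a 1] that
    by (cases t "1 :: real" rule: linorder_cases) auto
  show ?thesis
    using *[of t a] *[of "-t" "-a"] a t by (cases "0 \<le> t") auto
qed

lemma ex_bisected_chord:
  fixes N :: "'a::euclidean_space \<Rightarrow> real"
  assumes N: "is_norm N" and p: "N p < 1" and V: "subspace V" "2 \<le> dim V"
  obtains b where "b \<in> V" "N (p + b) = 1" "N (p - b) = 1"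
proof (rule ccontr)
  assume "\<not> thesis"
  with that have contra: "\<not> (N (p + b) = 1 \<and> N (p - b) = 1)" if "b \<in> V" for b
    using \<open>b \<in> V\<close> by blast
  \<comment> \<open>\<open>C x r\<close> says that \<open>r\<close> exceeds the half chord in
    direction \<open>x\<close> but not the one in direction \<open>- x\<close>. So \<open>U\<close>
    holds the directions with the shorter half. Its strict inequalities make \<open>U\<close> open
    without a continuous formula for the half lengths.\<close>
  define C where "C x r \<longleftrightarrow> 1 < N (p + r *\<^sub>R x) \<and> N (p - r *\<^sub>R x) < 1" for x r
  define U where "U = {x. \<exists>r>0. C x r}"
  have cont: "continuous_on S (\<lambda>x. N (f x))" if "continuous_on S f"
    for S :: "'b::topological_space set" and f
    using continuous_on_compose2[OF is_norm_continuous_on[OF N, of UNIV] that] by simp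
  have "open {x. C x r}" for r
    unfolding C_def
    by (intro open_Collect_conj open_Collect_less cont continuous_intros)
  moreover have "U = (\<Union>r\<in>{0<..}. {x. C x r})"
    by (auto simp: U_def)
  ultimately have "open U" by (metis (no_types, lifting) open_UN)
  have disj: "- x \<notin> U" if x: "x \<in> U" for x
  proof
    assume "- x \<in> U"
    then obtain s where s: "s > 0" "N (p + s *\<^sub>R x) < 1" "1 < N (p - s *\<^sub>R x)"
      by (auto simp: U_def C_def)
    obtain r where r: "r > 0" "1 < N (p + r *\<^sub>R x)" "N (p - r *\<^sub>R x) < 1"
      using x by (auto simp: U_def C_def)
    show False
      using is_norm_radial_less_one[OF N p, of s x r] is_norm_radial_less_one[OF N p, of r "-x" s]
        r s by (cases r s rule: linorder_cases) auto
  qed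
  have cover: "x \<in> U \<or> - x \<in> U" if x: "x \<in> V" "x \<noteq> 0" for x
  proof -
    \<comment> \<open>The radius with \<open>g r = 1\<close> is where the shorter half chord ends.
      At \<open>R\<close> the triangle inequality already puts \<open>p + R *\<^sub>R x\<close> on
      or outside the sphere.\<close>
    define g where "g r = max (N (p + r *\<^sub>R x)) (N (p - r *\<^sub>R x))" for r
    define R where "R = (1 + N p) / N x"
    have Nx: "0 < N x" and Np: "0 \<le> N p"
      using is_norm_pos[OF N x(2)] N by (auto simp: is_norm_def)
    then have "0 < R" by (simp add: R_def)
    have "N (R *\<^sub>R x) \<le> N (p + R *\<^sub>R x) + N (- p)"
      using is_norm_triangle[OF N, of "p + R *\<^sub>R x" "- p"] by simp
    then have "1 \<le> N (p + R *\<^sub>R x)"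
      using Nx \<open>0 < R\<close> by (simp add: is_norm_scaleR[OF N] is_norm_minus[OF N] R_def)
    then have "1 \<le> g R" by (simp add: g_def)
    moreover have "g 0 \<le> 1" using p by (simp add: g_def)
    moreover have "continuous_on {0..R} g"
      unfolding g_def by (intro continuous_on_max cont continuous_intros)
    ultimately obtain r where r: "0 \<le> r" "g r = 1"
      using IVT'[of g 0 1 R] \<open>0 < R\<close> by auto
    have "r > 0"
      using r p by (cases "r = 0") (auto simp: g_def)
    have pos: "y \<in> U" if y: "N (p + r *\<^sub>R y) = 1" "N (p - r *\<^sub>R y) < 1" for y
    proof -
      have "open {s. N (p - s *\<^sub>R y) < 1}"
        by (intro open_Collect_less cont continuous_intros)
      then obtain e where e: "e > 0" "\<And>s. dist s r < e \<Longrightarrow> N (p - s *\<^sub>R y) < 1"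
        using y(2) by (auto simp: open_dist)
      \<comment> \<open>Slightly beyond \<open>r\<close> the forward end is outside, while the
        opposite end is still inside by openness.\<close>
      define s where "s = r + e / 2"
      have "N (p - s *\<^sub>R y) < 1" "r < s"
        using e by (auto simp: s_def dist_real_def)
      moreover have "1 < N (p + s *\<^sub>R y)"
        using is_norm_radial_less_one[OF N p, of s y r] y(1) \<open>r < s\<close> r(1) by force
      ultimately have "C y s" "0 < s"
        using \<open>r > 0\<close> by (simp_all add: C_def)
      then show ?thesis by (auto simp: U_def)
    qed
    have "r *\<^sub>R x \<in> V" using V x by (simp add: subspace_scale)
    then have "\<not> (N (p + r *\<^sub>R x) = 1 \<and> N (p - r *\<^sub>R x) = 1)"
      using contra by blast
    then show ?thesis
      using r(2) pos[of x] pos[of "-x"] by (auto simp: g_def max_def split: if_splits)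
  qed
  \<comment> \<open>Dimension at least 2 enters here: a line without the origin is
    disconnected.\<close>
  have "aff_dim V \<noteq> 1"
    using V by (simp add: aff_dim_subspace)
  then have "connected (V - {0})"
    using connected_punctured_convex subspace_imp_convex V(1) by blast
  moreover have "open (uminus ` U)"
    using \<open>open U\<close> open_negations by blast
  moreover have "V - {0} \<subseteq> U \<union> uminus ` U"
  proof
    fix x assume "x \<in> V - {0}"
    then show "x \<in> U \<union> uminus ` U"
      using cover[of x] by (auto simp: image_iff intro: bexI[of _ "-x"])
  qed
  moreover have "U \<inter> uminus ` U = {}"
    using disj by auto
  ultimately have none: "U \<inter> (V - {0}) = {} \<or> uminus ` U \<inter> (V - {0}) = {}"
    using \<open>open U\<close> unfolding connected_def by blast
  obtain x where x: "x \<in> V" "x \<noteq> 0"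
    using V by (metis dim_eq_0 not_numeral_le_zero subsetI singletonI)
  moreover have "- x \<in> V"
    using V x by (simp add: subspace_neg)
  ultimately have "x \<in> U \<or> - x \<in> U" "x \<in> V - {0}" "- x \<in> V - {0}"
    using cover by auto
  then show False
    using none by (metis IntI emptyE image_eqI minus_minus)
qed

lemma subspace_hyperplane_separating:
  fixes a b :: "'a::euclidean_space"
  assumes V: "subspace V" "a \<in> V" "b \<in> V" and ab: "b \<noteq> 0" "a \<notin> span {b}"
  obtains W where "subspace W" "W \<subseteq> V" "b \<in> W" "a \<notin> W" "Suc (dim W) = dim V"
    "span (insert a W) = V"
proof -
  have "independent {a, b}"
    using ab by (auto simp: independent_insert)
  then obtain B where B: "{a, b} \<subseteq> B" "B \<subseteq> V" "independent B" "V \<subseteq> span B"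
    using maximal_independent_subset_extend[of "{a, b}" V] V by auto
  have sB: "span B = V"
    using B V by (metis span_minimal subset_antisym)
  define W where "W = span (B - {a})"
  have iW: "independent (B - {a})"
    using B(3) independent_mono by blast
  have "finite B" using B(3) independent_imp_finite by blast
  have "b \<noteq> a" using ab span_base by blast
  show thesis
  proof
    show "subspace W" by (simp add: W_def)
    show "W \<subseteq> V" unfolding W_def using sB by (metis Diff_subset span_mono)
    show "b \<in> W" unfolding W_def using B \<open>b \<noteq> a\<close> by (simp add: span_base)
    show "a \<notin> W"
      unfolding W_def using B(1,3) by (auto simp: dependent_def)
    have "dim W = card (B - {a})" "dim V = card B"
      using dim_span_eq_card_independent[OF iW] dim_span_eq_card_independent[OF B(3)] sB
      by (simp_all add: W_def)
    then show "Suc (dim W) = dim V"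
      using \<open>finite B\<close> B(1) by (metis card_Suc_Diff1 insert_subset)
    show "span (insert a W) = V"
    proof
      show "span (insert a W) \<subseteq> V"
        using V \<open>W \<subseteq> V\<close> by (intro span_minimal) auto
      have "B \<subseteq> insert a W" by (auto simp: W_def intro: span_base)
      then show "V \<subseteq> span (insert a W)" using sB span_mono by blast
    qed
  qed
qed

text \<open>Vertices are recorded relative to \<open>p\<close>, so \<open>\<Sum>B = 0\<close> says
  that their centroid is \<open>p\<close>. The clause \<open>span B = V\<close> is carried along
  because it yields affine independence at the end.\<close>

lemma ex_inscribed_vertices:
  fixes N :: "'a::euclidean_space \<Rightarrow> real"
  assumes "is_norm N" "N p < 1" "subspace V" "dim V = Suc k"
    and "a \<in> V" "N (p + a) = 1" "N (p - a) = 1"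
  shows "\<exists>B. finite B \<and> card B = Suc (Suc k) \<and> a \<in> B \<and> span B = V \<and> \<Sum>B = 0 \<and>
             (\<forall>b\<in>B. N (p + b) = 1)"
  using assms
proof (induction k arbitrary: p V a)
  case 0
  have a0: "a \<noteq> 0" using 0 by auto
  have "2 *\<^sub>R a \<noteq> 0" using a0 by simp
  then have "a \<noteq> - a" by (simp add: eq_neg_iff_add_eq_0 scaleR_2)
  have "span {a, - a} = V"
  proof (rule subspace_dim_equal)
    have "span {a} \<subseteq> span {a, - a}" by (rule span_mono) auto
    then show "dim V \<le> dim (span {a, - a})"
      using 0 a0 dim_subset[of "span {a}" "span {a, - a}"] by (simp add: dim_insert)
    show "span {a, - a} \<subseteq> V"
      using 0 by (intro span_minimal) (auto simp: subspace_neg)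
  qed (use 0 in auto)
  then show ?case
    using 0 \<open>a \<noteq> - a\<close> by (intro exI[of _ "{a, - a}"]) auto
next
  case (Suc k)
  note N = \<open>is_norm N\<close>
  \<comment> \<open>\<open>n\<close> is the dimension of \<open>V\<close> and the number of vertices
    other than \<open>a\<close>. Relative to \<open>p\<close> these must sum to \<open>- a\<close>,
    so their centroid is \<open>p - c\<close>.\<close>
  define n where "n = real (Suc (Suc k))"
  define c where "c = (1 / n) *\<^sub>R a"
  define q where "q = p - c"
  have n: "2 \<le> n" by (simp add: n_def)
  have q: "N q < 1"
    using is_norm_radial_less_one[OF N Suc.prems(2), of 1 "- a" "1 / n"] Suc.prems(7) n
    by (simp add: q_def c_def)
  obtain b where b: "b \<in> V" "N (q + b) = 1" "N (q - b) = 1"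
    using ex_bisected_chord[OF N q Suc.prems(3)] Suc.prems(4) by auto
  have b0: "b \<noteq> 0" using b q by auto
  have "a \<notin> span {b}"
  proof
    assume "a \<in> span {b}"
    then obtain s where s: "a = s *\<^sub>R b" by (auto simp: span_singleton)
    have "a \<noteq> 0" using Suc.prems by auto
    then have "b = (1 / s) *\<^sub>R a" using s by auto
    then have "N (p + (1 / s - 1 / n) *\<^sub>R a) = 1" "N (p + (- 1 / s - 1 / n) *\<^sub>R a) = 1"
      using b by (simp_all add: q_def c_def algebra_simps)
    \<comment> \<open>The two parameters are \<plusminus>1, yet their sum \<open>- 2 / n\<close>
      lies strictly between -2 and 0.\<close>
    then have "\<bar>1 / s - 1 / n\<bar> = 1" "\<bar>- 1 / s - 1 / n\<bar> = 1"
      using is_norm_chord_parameter[OF N Suc.prems(2) Suc.prems(6,7)] by blast+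
    moreover have "0 < 1 / n" "1 / n < 1" using n by auto
    ultimately show False by linarith
  qed
  then obtain W where W: "subspace W" "W \<subseteq> V" "b \<in> W" "a \<notin> W" "Suc (dim W) = dim V"
    "span (insert a W) = V"
    using subspace_hyperplane_separating[OF Suc.prems(3,5) b(1) b0] by metis
  have "dim W = Suc k" using W Suc.prems(4) by simp
  from Suc.IH[OF N q W(1) this W(3) b(2,3)] obtain B
    where B: "finite B" "card B = Suc (Suc k)" "span B = W" "\<Sum>B = 0" "\<forall>b\<in>B. N (q + b) = 1"
    by blast
  \<comment> \<open>The shift changes the reference point from \<open>q\<close> to \<open>p\<close>,
    as \<open>q + x = p + (x - c)\<close>. Over the \<open>n\<close> elements of \<open>B\<close> it
    adds up to \<open>- a\<close>, which the new vertex \<open>a\<close> cancels.\<close>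
  define B' where "B' = (\<lambda>x. x - c) ` B"
  have inj: "inj_on (\<lambda>x. x - c) B" by (auto simp: inj_on_def)
  have "a \<notin> B'"
  proof
    assume "a \<in> B'"
    \<comment> \<open>\<open>a + c\<close> is a nonzero multiple of \<open>a\<close>, which
      \<open>W\<close> avoids.\<close>
    then have "a + c \<in> W" using B(3) by (auto simp: B'_def intro: span_base)
    then have "(1 / (1 + 1 / n)) *\<^sub>R (a + c) \<in> W" using W(1) subspace_scale by blast
    moreover have "a + c = (1 + 1 / n) *\<^sub>R a" by (simp add: c_def algebra_simps)
    moreover have "1 + 1 / n \<noteq> 0" using n by (smt (verit) divide_nonneg_nonneg)
    ultimately show False using W(4) by simp
  qed
  have "(\<Sum>x\<in>B'. x) = (\<Sum>x\<in>B. x - c)"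
    unfolding B'_def using inj by (simp add: sum.reindex)
  also have "\<dots> = - a"
    using B n by (simp add: sum_subtractf sum_constant_scaleR c_def n_def)
  finally have sumB': "\<Sum>B' = - a" .
  have c: "c \<in> span (insert a S)" for S
    unfolding c_def by (intro span_scale span_base) auto
  have "span (insert a B') = V"
  proof
    have "c \<in> V" using Suc.prems by (simp add: c_def subspace_scale)
    then have "B' \<subseteq> V"
      using B(3) W(2) Suc.prems(3) by (auto simp: B'_def intro!: subspace_diff dest: span_base)
    then show "span (insert a B') \<subseteq> V"
      using Suc.prems by (intro span_minimal) auto
    have "x \<in> span (insert a B')" if "x \<in> B" for x
      using span_add[OF span_base[of "x - c" "insert a B'"] c] that by (auto simp: B'_def)
    then have "W \<subseteq> span (insert a B')"
      using B(3) by (metis span_minimal subsetI subspace_span)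
    then show "V \<subseteq> span (insert a B')"
      using W(6) by (metis insertI1 insert_subset span_base span_minimal subspace_span)
  qed
  moreover have "N (p + x) = 1" if "x \<in> B'" for x
    using that B(5) by (auto simp: B'_def q_def algebra_simps)
  ultimately show ?case
    using \<open>a \<notin> B'\<close> sumB' B(1,2) inj Suc.prems(6)
    by (intro exI[of _ "insert a B'"]) (auto simp: B'_def card_image)
qed

text \<open>The mean of \<open>B\<close> is 0, so 0 lies in the affine hull and the affine dimension
  equals the linear one, which is one less than the number of points.\<close>

lemma affine_independent_if_sum_zero:
  fixes B :: "'a::euclidean_space set"
  assumes B: "finite B" "card B = Suc (dim B)" "\<Sum>B = 0"
  shows "\<not> affine_dependent B"
proof -
  have "(\<Sum>x\<in>B. (1 / real (card B)) *\<^sub>R x) = 0"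
    using B(3) by (simp flip: scaleR_sum_right)
  then have "0 \<in> affine hull B"
    unfolding affine_hull_finite[OF B(1)] using B(2)
    by (auto intro!: exI[of _ "\<lambda>_. 1 / real (card B)"])
  then have "aff_dim B = int (dim B)"
    by (rule aff_dim_zero)
  then show ?thesis
    using B by (simp add: affine_independent_iff_card)
qed

theorem theorem3p1:
  fixes N :: "real ^ 'n \<Rightarrow> real" and P0 :: "real ^ 'n"
  assumes "CARD('n) \<ge> 2"
    and "is_norm N"
    and "P0 \<in> mink_sphere N 0 1"
  shows "\<exists>T. int CARD('n) simplex T \<and> AG_quasiregular N T \<and> P0 \<in> vertices T \<and>
             is_circumsphere N (mink_sphere N 0 1) T"
proof -
  note N = assms(2)
  have P0: "N P0 = 1" using assms(3) by (simp add: mink_sphere_def)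
  have dim: "dim (UNIV :: (real ^ 'n) set) = Suc (CARD('n) - 1)" by simp
  obtain B where B: "finite B" "card B = Suc CARD('n)" "P0 \<in> B" "span B = UNIV" "\<Sum>B = 0"
    "\<forall>b\<in>B. N b = 1"
    \<comment> \<open>The descent starts at the center 0, which bisects the chord from
      \<open>P0\<close> to \<open>- P0\<close>.\<close>
    using ex_inscribed_vertices[OF N _ subspace_UNIV dim, of 0 P0]
    by (auto simp: P0 is_norm_zero[OF N] is_norm_minus[OF N])
  have "dim B = CARD('n)"
    using B(4) by (metis DIM_cart DIM_real dim_UNIV dim_span nat_mult_1_right)
  then have ind: "\<not> affine_dependent B"
    using B affine_independent_if_sum_zero by metis
  define T where "T = convex hull B"
  have vert: "vertices T = B"
    using extreme_point_of_convex_hull_affine_independent[OF ind]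
    by (simp add: vertices_def T_def)
  have simp: "int CARD('n) simplex T"
    using ind B(2) unfolding simplex_def T_def by auto
  have sphere: "is_circumsphere N (mink_sphere N 0 1) T"
    using B(6) vert unfolding is_circumsphere_def
    by (intro exI[of _ 0] exI[of _ 1]) (auto simp: mink_sphere_def)
  then have "is_circumcenter N 0 T"
    unfolding is_circumcenter_def by (intro exI[of _ 1]) simp
  moreover have "centroid T = 0"
    using B(5) vert by (simp add: centroid_def)
  ultimately show ?thesis
    using simp sphere vert B(3) unfolding AG_quasiregular_def by metis
qed

end
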